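(* Let $d=2$. Then for every $\lambda\in\mathbb{C}$ with $\lambda\neq[V]$, the Laurent polynomial $z\mapsto\mathcal{P}(z,\lambda)$ is irreducible (it admits no factorization $fg$ into two Laurent polynomials in $z$ neither of which is a monomial). Moreover, if $\mathcal{P}(\cdot,[V])$ is reducible, then it has exactly two distinct non-monomial irreducible factors, each of multiplicity one.
   Context: Fix positive integers $q_1,q_2$ with greatest common divisor $1$, $Q=q_1q_2$, $\Gamma=q_1\mathbb{Z}\oplus q_2\mathbb{Z}$, and a $\Gamma$-periodic $V:\mathbb{Z}^2\to\mathbb{C}$. The discrete Laplacian is $(\Delta u)(n)=\sum_{\|n'-n\|_1=1}u(n')$. Let $W=\{(n_1,n_2):0\le n_j\le q_j-1\}$. For $z\in(\mathbb{C}\setminus\{0\})^2$, the space of $u:\mathbb{Z}^2\to\mathbb{C}$ with $u(n+q_je_j)=z_ju(n)$ ($j=1,2$) is identified with $\mathbb{C}^W$ by restriction; $\mathcal{D}(z)$ is the $Q\times Q$ matrix of $-\Delta+V$ on this space, and $\mathcal{P}(z,\lambda)=\det(\mathcal{D}(z)-\lambda I)$, a Laurent polynomial in $z_1,z_2$ and polynomial in $\lambda$. A monomial is $Cz_1^{a_1}z_2^{a_2}$ with $C\ne0$, $a_j\in\mathbb{Z}$. $[V]=\frac{1}{Q}\sum_{n\in W}V(n)$. *)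

theory Defs
  imports "HOL-Library.Poly_Mapping" "HOL-Library.Product_Plus"
          "HOL-Combinatorics.Permutations" Complex_Main
begin

text \<open>Laurent polynomials in z1, z2 with complex coefficients: the group ring of Z^2,
  i.e. finitely supported coefficient functions on exponent pairs, with convolution product.\<close>
type_synonym lpoly = "(int \<times> int) \<Rightarrow>\<^sub>0 complex"

definition lmonom :: "int \<times> int \<Rightarrow> lpoly" where
  "lmonom a = Poly_Mapping.single a 1"

definition lconst :: "complex \<Rightarrow> lpoly" where
  "lconst c = Poly_Mapping.single (0,0) c"

definition is_monomial :: "lpoly \<Rightarrow> bool" where
  "is_monomial f \<longleftrightarrow> (\<exists>a c. c \<noteq> 0 \<and> f = Poly_Mapping.single a c)"

definition laurent_irreducible :: "lpoly \<Rightarrow> bool" where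
  "laurent_irreducible f \<longleftrightarrow> \<not> (\<exists>g h. f = g * h \<and> \<not> is_monomial g \<and> \<not> is_monomial h)"

definition fundamental_domain :: "nat \<Rightarrow> nat \<Rightarrow> (int \<times> int) set" where
  "fundamental_domain q1 q2 = {0..<int q1} \<times> {0..<int q2}"

definition periodic_potential :: "nat \<Rightarrow> nat \<Rightarrow> (int \<times> int \<Rightarrow> complex) \<Rightarrow> bool" where
  "periodic_potential q1 q2 V \<longleftrightarrow>
     (\<forall>n1 n2. V (n1 + int q1, n2) = V (n1, n2) \<and> V (n1, n2 + int q2) = V (n1, n2))"

definition neighbors_dirs :: "(int \<times> int) set" where
  "neighbors_dirs = {(1,0), (-1,0), (0,1), (0,-1)}"

text \<open>Matrix entry (m,w), m,w in W, of the Floquet matrix D(z) of -Delta + V: a lattice point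
  n' = w + (k1 q1, k2 q2) with w in W contributes u(n') = z1^k1 z2^k2 u(w).\<close>
definition floquet_entry :: "nat \<Rightarrow> nat \<Rightarrow> (int \<times> int \<Rightarrow> complex) \<Rightarrow> int \<times> int \<Rightarrow> int \<times> int \<Rightarrow> lpoly" where
  "floquet_entry q1 q2 V m w =
     (if m = w then lconst (V m) else 0)
     - (\<Sum>d\<in>neighbors_dirs.
          (let n' = m + d in
           if (fst n' mod int q1, snd n' mod int q2) = w
           then lmonom (fst n' div int q1, snd n' div int q2) else 0))"

definition det_on :: "'i set \<Rightarrow> ('i \<Rightarrow> 'i \<Rightarrow> 'a::comm_ring_1) \<Rightarrow> 'a" where
  "det_on I M = (\<Sum>p | p permutes I. of_int (sign p) * (\<Prod>i\<in>I. M i (p i)))"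

definition floquet_poly :: "nat \<Rightarrow> nat \<Rightarrow> (int \<times> int \<Rightarrow> complex) \<Rightarrow> complex \<Rightarrow> lpoly" where
  "floquet_poly q1 q2 V lam = det_on (fundamental_domain q1 q2)
     (\<lambda>m w. floquet_entry q1 q2 V m w - (if m = w then lconst lam else 0))"

definition avg_potential :: "nat \<Rightarrow> nat \<Rightarrow> (int \<times> int \<Rightarrow> complex) \<Rightarrow> complex" where
  "avg_potential q1 q2 V = (\<Sum>n\<in>fundamental_domain q1 q2. V n) / of_nat (q1 * q2)"

end

theory Submission
  imports Defs "HOL-Library.FuncSet"
begin

text \<open>
  Expanding the determinant over choices of a move for every site of the torus
  \<open>W = Z/q1 \<times> Z/q2\<close> shows that the exponents \<open>a\<close> of \<open>P\<close> satisfy \<open>q1 |a1| + q2 |a2| \<le> q1 q2\<close>, and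
  that each of the four vertices of this rhombus comes from exactly one term (a translation), so it
  does occur. The edges \<open>(q2, \<plusminus>q1)\<close> are primitive vectors because \<open>q1\<close> and \<open>q2\<close> are coprime, so
  the only nontrivial way to write the rhombus as a Minkowski sum is as a sum of two
  segments without interior lattice points. Hence in a factorization into two non-monomials both
  factors are binomials, which are irreducible and not associated, and \<open>P\<close> has no exponents with
  \<open>q1 a1 + q2 a2 = q1 q2 - 1\<close>. The terms on this layer leave a single site \<open>n\<close> fixed and move
  all others by \<open>(1, 0)\<close> or \<open>(0, 1)\<close>. For each \<open>n\<close> there is exactly one such term, and they are
  translates of each other, so the coefficient is \<open>\<plusminus>\<Sum>n. (V n - \<lambda>)\<close> and
  \<open>\<lambda>\<close> must be the mean of \<open>V\<close>.
\<close>

section \<open>Weights and extremal exponents of products\<close>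

abbreviation "keys \<equiv> Poly_Mapping.keys"
abbreviation "lookup \<equiv> Poly_Mapping.lookup"

definition wt :: "int \<times> int \<Rightarrow> int \<times> int \<Rightarrow> int" where
  "wt w a = fst w * fst a + snd w * snd a"

lemma wt_add: "wt w (a + b) = wt w a + wt w b"
  by (simp add: wt_def algebra_simps)

text \<open>Breaking ties lexicographically refines the weight to a total order compatible with
  addition, so the maximiser is unique and leading terms cannot cancel.\<close>

lemma exists_lex_max:
  assumes "finite S" "S \<noteq> {}"
  shows "\<exists>a\<in>S. \<forall>b\<in>S. wt w b < wt w a \<or>
    (wt w b = wt w a \<and> (fst b < fst a \<or> fst b = fst a \<and> snd b \<le> snd a))"
  using assms
proof (induction S rule: finite_ne_induct)
  case (singleton x)
  then show ?case by auto
next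
  case (insert x F)
  then obtain a where a: "a \<in> F" "\<forall>b\<in>F. wt w b < wt w a \<or>
    (wt w b = wt w a \<and> (fst b < fst a \<or> fst b = fst a \<and> snd b \<le> snd a))" by blast
  show ?case
  proof (cases "wt w x < wt w a \<or> (wt w x = wt w a \<and> (fst x < fst a \<or> fst x = fst a \<and> snd x \<le> snd a))")
    case True
    with a show ?thesis by blast
  next
    case False
    then have "\<forall>b\<in>F. wt w b < wt w x \<or>
      (wt w b = wt w x \<and> (fst b < fst x \<or> fst b = fst x \<and> snd b \<le> snd x))"
      using a(2) by force
    then show ?thesis by force
  qed
qed

lemma lookup_mult_diff:
  fixes f g :: lpoly
  shows "lookup (f * g) c = Sum_any (\<lambda>l. lookup f l * lookup g (c - l))"
proof -
  have "Sum_any (\<lambda>q. lookup g q when c = l + q) = lookup g (c - l)" for l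
  proof -
    have "(\<lambda>q. lookup g q when c = l + q) = (\<lambda>q. lookup g q when q = c - l)"
      by (auto simp: when_def)
    then show ?thesis by (simp only: Sum_any_when_equal)
  qed
  then show ?thesis by (simp only: lookup_mult)
qed

lemma exists_keys_mult_max:
  fixes f g :: lpoly
  assumes "f \<noteq> 0" "g \<noteq> 0"
  shows "\<exists>a\<in>keys f. \<exists>b\<in>keys g. (\<forall>x\<in>keys f. wt w x \<le> wt w a) \<and>
    (\<forall>y\<in>keys g. wt w y \<le> wt w b) \<and> a + b \<in> keys (f * g)"
proof -
  from assms have ne: "keys f \<noteq> {}" "keys g \<noteq> {}" by auto
  obtain a where a: "a \<in> keys f" "\<forall>x\<in>keys f. wt w x < wt w a \<or>
    (wt w x = wt w a \<and> (fst x < fst a \<or> fst x = fst a \<and> snd x \<le> snd a))"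
    using exists_lex_max[OF finite_keys ne(1)] by blast
  obtain b where b: "b \<in> keys g" "\<forall>x\<in>keys g. wt w x < wt w b \<or>
    (wt w x = wt w b \<and> (fst x < fst b \<or> fst x = fst b \<and> snd x \<le> snd b))"
    using exists_lex_max[OF finite_keys ne(2)] by blast
  \<comment> \<open>The order ranks \<open>l\<close> at most \<open>a\<close> and
    \<open>a + b - l\<close> at most \<open>b\<close>; as the sums agree, both comparisons are
    equalities.\<close>
  have zero: "lookup f l * lookup g (a + b - l) = 0" if "l \<noteq> a" for l
  proof (rule ccontr)
    assume "\<not> ?thesis"
    then have l: "l \<in> keys f" "a + b - l \<in> keys g" by (auto simp: in_keys_iff)
    have w: "wt w l + wt w (a + b - l) = wt w a + wt w b"
      by (simp add: wt_def algebra_simps)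
    show False
      using a(2)[rule_format, OF l(1)] b(2)[rule_format, OF l(2)] w that
      by (auto simp: prod_eq_iff)
  qed
  have "lookup (f * g) (a + b) = (\<Sum>l\<in>{a}. lookup f l * lookup g (a + b - l))"
    unfolding lookup_mult_diff by (rule Sum_any.expand_superset) (use zero in auto)
  also have "\<dots> \<noteq> 0" using a(1) b(1) by (simp add: in_keys_iff)
  finally have "a + b \<in> keys (f * g)" by (simp add: in_keys_iff)
  with a b show ?thesis by (force intro: bexI[of _ a] bexI[of _ b])
qed

text \<open>The maximal weights of \<open>f\<close> and \<open>g\<close> add up to a weight that
  occurs in \<open>f * g\<close>, hence to at most \<open>wt w (a + b)\<close>; so neither
  \<open>a\<close> nor \<open>b\<close> can fall short of its maximum.\<close>

lemma wt_max_factors: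
  fixes f g :: lpoly
  assumes "a \<in> keys f" "b \<in> keys g" "\<And>c. c \<in> keys (f * g) \<Longrightarrow> wt w c \<le> wt w (a + b)"
  shows "x \<in> keys f \<Longrightarrow> wt w x \<le> wt w a" and "y \<in> keys g \<Longrightarrow> wt w y \<le> wt w b"
proof -
  have "f \<noteq> 0" "g \<noteq> 0" using assms(1,2) by auto
  then obtain a' b' where ab: "a' \<in> keys f" "b' \<in> keys g" "\<forall>x\<in>keys f. wt w x \<le> wt w a'"
    "\<forall>y\<in>keys g. wt w y \<le> wt w b'" "a' + b' \<in> keys (f * g)"
    using exists_keys_mult_max by meson
  have "wt w a' + wt w b' \<le> wt w a + wt w b"
    using assms(3)[OF ab(5)] by (simp add: wt_add)
  with ab(3,4) assms(1,2) have "wt w a = wt w a'" "wt w b = wt w b'" by (smt (verit))+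
  with ab(3,4) show "x \<in> keys f \<Longrightarrow> wt w x \<le> wt w a" "y \<in> keys g \<Longrightarrow> wt w y \<le> wt w b" by auto
qed

lemma wt_min_factors:
  fixes f g :: lpoly
  assumes "a \<in> keys f" "b \<in> keys g" "\<And>c. c \<in> keys (f * g) \<Longrightarrow> wt w (a + b) \<le> wt w c"
  shows "x \<in> keys f \<Longrightarrow> wt w a \<le> wt w x" and "y \<in> keys g \<Longrightarrow> wt w b \<le> wt w y"
proof -
  have neg: "wt (- w) c = - wt w c" for c by (simp add: wt_def)
  show "x \<in> keys f \<Longrightarrow> wt w a \<le> wt w x" "y \<in> keys g \<Longrightarrow> wt w b \<le> wt w y"
    using wt_max_factors[OF assms(1,2), of "- w"] assms(3) by (auto simp: neg)
qed

lemma keys_multE: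
  fixes f g :: lpoly
  assumes "c \<in> keys (f * g)"
  obtains a b where "a \<in> keys f" "b \<in> keys g" "c = a + b"
  using assms keys_mult[of f g] by blast

section \<open>Irreducibility of primitive binomials\<close>

lemma is_monomial_iff_keys: "is_monomial f \<longleftrightarrow> (\<exists>a. keys f = {a})"
proof
  assume "\<exists>a. keys f = {a}"
  then obtain a where a: "keys f = {a}" by blast
  have "f = Poly_Mapping.single a (lookup f a)"
    by (rule poly_mapping_eqI) (use a in \<open>auto simp: lookup_single when_def in_keys_iff set_eq_iff\<close>)
  moreover have "lookup f a \<noteq> 0" using a by (metis insertI1 in_keys_iff)
  ultimately show "is_monomial f" unfolding is_monomial_def by blast
qed (auto simp: is_monomial_def)

text \<open>Turns orthogonality to a normal vector into an integer multiple of a primitive edge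
  vector.\<close>

lemma coprime_parallelE:
  fixes p r x y :: int
  assumes "coprime p r" "r * x = p * y"
  obtains s where "x = s * p" "y = s * r"
proof -
  have "p dvd r * x" using assms(2) by simp
  then have "p dvd x" using assms(1) by (simp add: coprime_dvd_mult_right_iff)
  then obtain s where s: "x = s * p" by (metis dvdE mult.commute)
  have py: "p * (y - s * r) = 0" using assms(2) s by (auto simp add: algebra_simps)
  show ?thesis
  proof (cases "p = 0")
    \<comment> \<open>Here \<open>p = 0\<close> says nothing about \<open>y\<close>, but
      \<open>r\<close> is 1 or -1, so \<open>y * r\<close> serves as the multiplier.\<close>
    case True
    then have "is_unit r" using assms(1) by simp
    then have "r * r = 1" by (auto simp: zdvd1_eq abs_if split: if_splits)
    then have "y = (y * r) * r" by (simp add: mult.assoc)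
    moreover have "x = (y * r) * p" using True s by simp
    ultimately show ?thesis using that by blast
  next
    case False
    with py s that show ?thesis by simp
  qed
qed

text \<open>The Newton polygon is a segment of lattice length 1. The factors occupy parallel
  segments of nonnegative integer lengths \<open>s\<close> and \<open>t\<close> with
  \<open>s + t = 1\<close>, so one of them is a point.\<close>

lemma binomial_laurent_irreducible:
  assumes cop: "coprime p r" and keys: "keys f = {e, e + (p, r)}"
  shows "laurent_irreducible f"
  unfolding laurent_irreducible_def
proof clarify
  fix g h
  assume f: "f = g * h" and ng: "\<not> is_monomial g" and nh: "\<not> is_monomial h"
  obtain a b where ab: "a \<in> keys g" "b \<in> keys h" "e = a + b"
    using keys f keys_multE[of e g h] by blast
  obtain a' b' where ab': "a' \<in> keys g" "b' \<in> keys h" "e + (p, r) = a' + b'"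
    using keys f keys_multE[of "e + (p, r)" g h] by blast
  have pos: "p * p + r * r > 0"
    using cop by (cases "p = 0") (auto simp: sum_squares_gt_zero_iff zero_less_mult_iff)
  \<comment> \<open>\<open>(r, -p)\<close> is normal to the segment; being constant on the product,
    it is constant on each factor.\<close>
  have const: "wt (r, -p) c = wt (r, -p) (a + b)" if "c \<in> keys (g * h)" for c
    using that keys unfolding f[symmetric] ab(3)[symmetric] by (auto simp: wt_def algebra_simps)
  have between: "wt (p, r) c \<le> wt (p, r) (a' + b')" "wt (p, r) (a + b) \<le> wt (p, r) c"
    if "c \<in> keys (g * h)" for c
    using that keys pos unfolding f[symmetric] ab(3)[symmetric] ab'(3)[symmetric]
    by (auto simp: wt_def algebra_simps)
  have cg: "wt (r, -p) x = wt (r, -p) a" if "x \<in> keys g" for x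
    using wt_max_factors(1)[OF ab(1,2) _ that, of "(r, -p)"]
      wt_min_factors(1)[OF ab(1,2) _ that, of "(r, -p)"] const by fastforce
  have ch: "wt (r, -p) x = wt (r, -p) b" if "x \<in> keys h" for x
    using wt_max_factors(2)[OF ab(1,2) _ that, of "(r, -p)"]
      wt_min_factors(2)[OF ab(1,2) _ that, of "(r, -p)"] const by fastforce
  have bg: "wt (p, r) a \<le> wt (p, r) x" "wt (p, r) x \<le> wt (p, r) a'" if "x \<in> keys g" for x
    using wt_max_factors(1)[OF ab'(1,2) between(1) that]
      wt_min_factors(1)[OF ab(1,2) between(2) that] by auto
  have bh: "wt (p, r) b \<le> wt (p, r) x" "wt (p, r) x \<le> wt (p, r) b'" if "x \<in> keys h" for x
    using wt_max_factors(2)[OF ab'(1,2) between(1) that]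
      wt_min_factors(2)[OF ab(1,2) between(2) that] by auto
  have par: "\<exists>s. x = y + (s * p, s * r)" if "wt (r, -p) x = wt (r, -p) y" for x y
  proof -
    have "r * (fst x - fst y) = p * (snd x - snd y)"
      using that by (simp add: wt_def algebra_simps)
    then obtain s where "fst x - fst y = s * p" "snd x - snd y = s * r"
      using coprime_parallelE[OF cop] by blast
    then show ?thesis by (intro exI[of _ s]) (auto simp: prod_eq_iff)
  qed
  have wtp: "wt (p, r) (y + (s * p, s * r)) = wt (p, r) y + s * (p * p + r * r)" for y s
    by (simp add: wt_def algebra_simps)
  obtain s where s: "a' = a + (s * p, s * r)" using par[OF cg[OF ab'(1)]] by blast
  obtain t where t: "b' = b + (t * p, t * r)" using par[OF ch[OF ab'(2)]] by blast
  have "s \<ge> 0" using bg(1)[OF ab'(1)] pos unfolding s wtp by (simp add: zero_le_mult_iff)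
  have "t \<ge> 0" using bh(1)[OF ab'(2)] pos unfolding t wtp by (simp add: zero_le_mult_iff)
  have "wt (p, r) ((0, 0) + (1 * p, 1 * r)) = wt (p, r) ((0,0) + ((s + t) * p, (s + t) * r))"
    using ab'(3) unfolding ab(3) s t by (auto simp: algebra_simps)
  then have st: "s + t = 1" using pos unfolding wtp by auto
  \<comment> \<open>The normal and the direction of the segment are independent functionals and
    separate points.\<close>
  have single: "x = y" if eq: "wt (r, -p) x = wt (r, -p) y" "wt (p, r) x = wt (p, r) y" for x y
  proof -
    obtain k where k: "x = y + (k * p, k * r)" using par[OF eq(1)] by blast
    with eq(2) pos have "k = 0" unfolding k wtp by auto
    with k show ?thesis by (simp add: prod_eq_iff)
  qed
  show False
  proof (cases "s = 0")
    case True
    then have "a' = a" using s by (simp add: prod_eq_iff)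
    then have "x = a" if "x \<in> keys g" for x
      using bg[OF that] by (intro single cg[OF that]) simp
    then have "keys g = {a}" using ab(1) by blast
    with ng show False by (auto simp: is_monomial_iff_keys)
  next
    case False
    with st \<open>s \<ge> 0\<close> \<open>t \<ge> 0\<close> have "t = 0" by simp
    then have "b' = b" using t by (simp add: prod_eq_iff)
    then have "x = b" if "x \<in> keys h" for x
      using bh[OF that] by (intro single ch[OF that]) simp
    then have "keys h = {b}" using ab(2) by blast
    with nh show False by (auto simp: is_monomial_iff_keys)
  qed
qed

section \<open>Factorizations over a rhombus\<close>

text \<open>The vertices of the rhombus split as sums of exponents of \<open>f\<close> and \<open>g\<close>. The four differences of
  consecutive parts are multiples of the primitive edge vectors, and the multiplicities for
  \<open>f\<close> and \<open>g\<close> add up to 1 on each edge.\<close>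

lemma rhombus_factor_cases:
  fixes f g :: lpoly and q1 q2 :: int
  assumes q: "q1 > 0" "q2 > 0" "coprime q1 q2"
    and rh: "\<And>c. c \<in> keys (f * g) \<Longrightarrow> q1 * \<bar>fst c\<bar> + q2 * \<bar>snd c\<bar> \<le> q1 * q2"
    and vertices: "(q2, 0) \<in> keys (f * g)" "(- q2, 0) \<in> keys (f * g)"
      "(0, q1) \<in> keys (f * g)" "(0, - q1) \<in> keys (f * g)"
    and nf: "\<not> is_monomial f" and ng: "\<not> is_monomial g"
  shows "(\<exists>e e'. keys f = {e, e + (q2, - q1)} \<and> keys g = {e', e' + (q2, q1)}) \<or>
    (\<exists>e e'. keys g = {e, e + (q2, - q1)} \<and> keys f = {e', e' + (q2, q1)})"
proof -
  \<comment> \<open>Normals of the edges: \<open>w1\<close> for north-east and south-west,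
    \<open>w2\<close> for south-east and north-west. The vertices below are east, south, west
    (\<open>X\<close>) and north.\<close>
  define w1 w2 where "w1 = (q1, q2)" and "w2 = (q1, - q2)"
  obtain E E' where E: "E \<in> keys f" "E' \<in> keys g" "(q2, 0) = E + E'"
    using vertices(1) by (rule keys_multE)
  obtain S S' where S: "S \<in> keys f" "S' \<in> keys g" "(0, - q1) = S + S'"
    using vertices(4) by (rule keys_multE)
  obtain X X' where W: "X \<in> keys f" "X' \<in> keys g" "(- q2, 0) = X + X'"
    using vertices(2) by (rule keys_multE)
  obtain N N' where N: "N \<in> keys f" "N' \<in> keys g" "(0, q1) = N + N'"
    using vertices(3) by (rule keys_multE)
  have bound: "wt w1 c \<le> q1 * q2" "- (q1 * q2) \<le> wt w1 c" "wt w2 c \<le> q1 * q2"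
    "- (q1 * q2) \<le> wt w2 c" if "c \<in> keys (f * g)" for c
  proof -
    have "\<bar>q1 * fst c\<bar> + \<bar>q2 * snd c\<bar> \<le> q1 * q2"
      using rh[OF that] q by (simp add: abs_mult)
    then show "wt w1 c \<le> q1 * q2" "- (q1 * q2) \<le> wt w1 c" "wt w2 c \<le> q1 * q2"
      "- (q1 * q2) \<le> wt w2 c" by (auto simp: wt_def w1_def w2_def)
  qed
  have val: "wt w1 (E + E') = q1 * q2" "wt w1 (N + N') = q1 * q2" "wt w1 (X + X') = - (q1 * q2)"
    "wt w1 (S + S') = - (q1 * q2)" "wt w2 (E + E') = q1 * q2" "wt w2 (S + S') = q1 * q2"
    "wt w2 (X + X') = - (q1 * q2)" "wt w2 (N + N') = - (q1 * q2)"
    unfolding E(3)[symmetric] S(3)[symmetric] W(3)[symmetric] N(3)[symmetric]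
    by (simp_all add: wt_def w1_def w2_def)
  \<comment> \<open>Every vertex lies on two edges, so its part in a factor is extremal for both
    normals.\<close>
  have mf: "wt w1 x \<le> wt w1 E" "wt w1 x \<le> wt w1 N" "wt w2 x \<le> wt w2 E" "wt w2 x \<le> wt w2 S"
      "wt w1 X \<le> wt w1 x" "wt w1 S \<le> wt w1 x" "wt w2 X \<le> wt w2 x" "wt w2 N \<le> wt w2 x"
    if "x \<in> keys f" for x
    by (rule wt_max_factors(1)[OF E(1,2) _ that] wt_max_factors(1)[OF N(1,2) _ that]
        wt_max_factors(1)[OF S(1,2) _ that] wt_min_factors(1)[OF S(1,2) _ that]
        wt_min_factors(1)[OF W(1,2) _ that] wt_min_factors(1)[OF N(1,2) _ that];
        unfold val; erule bound)+
  have mg: "wt w1 x \<le> wt w1 E'" "wt w1 x \<le> wt w1 N'" "wt w2 x \<le> wt w2 E'" "wt w2 x \<le> wt w2 S'"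
      "wt w1 X' \<le> wt w1 x" "wt w1 S' \<le> wt w1 x" "wt w2 X' \<le> wt w2 x" "wt w2 N' \<le> wt w2 x"
    if "x \<in> keys g" for x
    by (rule wt_max_factors(2)[OF E(1,2) _ that] wt_max_factors(2)[OF N(1,2) _ that]
        wt_max_factors(2)[OF S(1,2) _ that] wt_min_factors(2)[OF S(1,2) _ that]
        wt_min_factors(2)[OF W(1,2) _ that] wt_min_factors(2)[OF N(1,2) _ that];
        unfold val; erule bound)+
  have par1: "\<exists>s. x = y + (s * q2, - (s * q1))" if "wt w1 x = wt w1 y" for x y
  proof -
    have "coprime q2 (- q1)" using q(3) by (simp add: coprime_commute)
    moreover have "(- q1) * (fst x - fst y) = q2 * (snd x - snd y)"
      using that by (simp add: wt_def w1_def algebra_simps)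
    ultimately obtain s where "fst x - fst y = s * q2" "snd x - snd y = s * (- q1)"
      by (rule coprime_parallelE)
    then show ?thesis by (intro exI[of _ s]) (auto simp: prod_eq_iff)
  qed
  have par2: "\<exists>s. x = y + (s * q2, s * q1)" if "wt w2 x = wt w2 y" for x y
  proof -
    have "coprime q2 q1" using q(3) by (simp add: coprime_commute)
    moreover have "q1 * (fst x - fst y) = q2 * (snd x - snd y)"
      using that by (simp add: wt_def w2_def algebra_simps)
    ultimately obtain s where "fst x - fst y = s * q2" "snd x - snd y = s * q1"
      by (rule coprime_parallelE)
    then show ?thesis by (intro exI[of _ s]) (auto simp: prod_eq_iff)
  qed
  have qq: "q1 * q2 > 0" using q by simp
  have shift: "wt w2 (y + (s * q2, - (s * q1))) = wt w2 y + s * (2 * (q1 * q2))"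
    "wt w1 (y + (s * q2, s * q1)) = wt w1 y + s * (2 * (q1 * q2))" for y s
    by (simp_all add: wt_def w1_def w2_def algebra_simps)
  \<comment> \<open>\<open>E\<close> and \<open>N\<close> both maximise \<open>w1\<close> on
    \<open>f\<close>, so they differ along that edge; likewise for the next three pairs.\<close>
  obtain s where s: "E = N + (s * q2, - (s * q1))" using par1 mf E(1) N(1) by (meson order_antisym)
  obtain s' where s': "E' = N' + (s' * q2, - (s' * q1))" using par1 mg E(2) N(2) by (meson order_antisym)
  obtain t where t: "E = S + (t * q2, t * q1)" using par2 mf E(1) S(1) by (meson order_antisym)
  obtain t' where t': "E' = S' + (t' * q2, t' * q1)" using par2 mg E(2) S(2) by (meson order_antisym)
  \<comment> \<open>Along an edge vector the other normal grows by \<open>2 * (q1 * q2)\<close>, and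
    its minimum is at the far end.\<close>
  have ge: "s \<ge> 0" "s' \<ge> 0" "t \<ge> 0" "t' \<ge> 0"
    using mf(8)[OF E(1), unfolded s shift] mg(8)[OF E(2), unfolded s' shift]
      mf(6)[OF E(1), unfolded t shift] mg(6)[OF E(2), unfolded t' shift] qq
    by (simp_all add: zero_le_mult_iff)
  \<comment> \<open>First coordinates of east minus north and of east minus south.\<close>
  have "q2 = s * q2 + s' * q2" "q2 = t * q2 + t' * q2"
    using E(3) N(3) S(3) s s' t t' by (auto simp: prod_eq_iff)
  then have sum: "s + s' = 1" "t + t' = 1" using q by (metis distrib_right mult_cancel_right1 less_irrefl)+
  have seg1: "keys h = {y, y + (q2, - q1)}"
    if h: "y \<in> keys h" "y + (q2, - q1) \<in> keys h" "\<And>x. x \<in> keys h \<Longrightarrow> wt w1 x = wt w1 y"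
      "\<And>x. x \<in> keys h \<Longrightarrow> wt w2 y \<le> wt w2 x \<and> wt w2 x \<le> wt w2 (y + (q2, - q1))" for h :: lpoly and y
  proof -
    have "x = y \<or> x = y + (q2, - q1)" if x: "x \<in> keys h" for x
    proof -
      obtain k where k: "x = y + (k * q2, - (k * q1))" using par1 h(3)[OF x] by blast
      have k2: "0 * (2 * (q1 * q2)) \<le> k * (2 * (q1 * q2))" "k * (2 * (q1 * q2)) \<le> 1 * (2 * (q1 * q2))"
        using h(4)[OF x] shift(1)[of y k] shift(1)[of y 1] k by auto
      have "0 \<le> k" "k \<le> 1"
        by (rule mult_right_le_imp_le[OF k2(1)] mult_right_le_imp_le[OF k2(2)]; use qq in simp)+
      then have "k = 0 \<or> k = 1" by auto
      with k show ?thesis by (auto simp: prod_eq_iff)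
    qed
    with h(1,2) show ?thesis by blast
  qed
  have seg2: "keys h = {y, y + (q2, q1)}"
    if h: "y \<in> keys h" "y + (q2, q1) \<in> keys h" "\<And>x. x \<in> keys h \<Longrightarrow> wt w2 x = wt w2 y"
      "\<And>x. x \<in> keys h \<Longrightarrow> wt w1 y \<le> wt w1 x \<and> wt w1 x \<le> wt w1 (y + (q2, q1))" for h :: lpoly and y
  proof -
    have "x = y \<or> x = y + (q2, q1)" if x: "x \<in> keys h" for x
    proof -
      obtain k where k: "x = y + (k * q2, k * q1)" using par2 h(3)[OF x] by blast
      have k2: "0 * (2 * (q1 * q2)) \<le> k * (2 * (q1 * q2))" "k * (2 * (q1 * q2)) \<le> 1 * (2 * (q1 * q2))"
        using h(4)[OF x] shift(2)[of y k] shift(2)[of y 1] k by auto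
      have "0 \<le> k" "k \<le> 1"
        by (rule mult_right_le_imp_le[OF k2(1)] mult_right_le_imp_le[OF k2(2)]; use qq in simp)+
      then have "k = 0 \<or> k = 1" by auto
      with k show ?thesis by (auto simp: prod_eq_iff)
    qed
    with h(1,2) show ?thesis by blast
  qed
  have pt: "x = y" if "wt w1 x = wt w1 y" "wt w2 x = wt w2 y" for x y
  proof -
    have "q1 * fst x = q1 * fst y" "q2 * snd x = q2 * snd y"
      using that unfolding wt_def w1_def w2_def by (simp_all only: fst_conv snd_conv)
    with q show ?thesis by (simp add: prod_eq_iff)
  qed
  \<comment> \<open>A factor with no share in either edge at the east vertex is a point. Otherwise
    each factor takes one of the two edge directions.\<close>
  consider "s = 0" "t = 0" | "s' = 0" "t' = 0" | "s = 1" "t = 0" "s' = 0" "t' = 1"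
    | "s = 0" "t = 1" "s' = 1" "t' = 0" using ge sum by force
  then show ?thesis
  proof cases
    case 1
    then have "N = E" "S = E" using s t by (auto simp: prod_eq_iff)
    then have "x = E" if "x \<in> keys f" for x
      using mf(1,3,6,8)[OF that] by (intro pt) auto
    then have "keys f = {E}" using E(1) by blast
    with nf show ?thesis by (auto simp: is_monomial_iff_keys)
  next
    case 2
    then have "N' = E'" "S' = E'" using s' t' by (auto simp: prod_eq_iff)
    then have "x = E'" if "x \<in> keys g" for x
      using mg(1,3,6,8)[OF that] by (intro pt) auto
    then have "keys g = {E'}" using E(2) by blast
    with ng show ?thesis by (auto simp: is_monomial_iff_keys)
  next
    case 3
    then have e: "E = N + (q2, - q1)" "S = E" "N' = E'" "E' = S' + (q2, q1)"
      using s t s' t' by (auto simp: prod_eq_iff)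
    have "keys f = {N, N + (q2, - q1)}"
    proof (rule seg1)
      fix x assume x: "x \<in> keys f"
      show "wt w1 x = wt w1 N"
        using mf(2,6)[OF x] mf(1)[OF N(1)] e(2) by simp
      show "wt w2 N \<le> wt w2 x \<and> wt w2 x \<le> wt w2 (N + (q2, - q1))"
        using mf(8,3)[OF x] e(1) by simp
    qed (use N(1) E(1) e(1) in simp_all)
    moreover have "keys g = {S', S' + (q2, q1)}"
    proof (rule seg2)
      fix x assume x: "x \<in> keys g"
      show "wt w2 x = wt w2 S'"
        using mg(4,8)[OF x] mg(3)[OF S(2)] e(3) by simp
      show "wt w1 S' \<le> wt w1 x \<and> wt w1 x \<le> wt w1 (S' + (q2, q1))"
        using mg(6,1)[OF x] e(4) by simp
    qed (use S(2) E(2) e(4) in simp_all)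
    ultimately show ?thesis by blast
  next
    case 4
    then have e: "E' = N' + (q2, - q1)" "S' = E'" "N = E" "E = S + (q2, q1)"
      using s t s' t' by (auto simp: prod_eq_iff)
    have "keys g = {N', N' + (q2, - q1)}"
    proof (rule seg1)
      fix x assume x: "x \<in> keys g"
      show "wt w1 x = wt w1 N'"
        using mg(2,6)[OF x] mg(1)[OF N(2)] e(2) by simp
      show "wt w2 N' \<le> wt w2 x \<and> wt w2 x \<le> wt w2 (N' + (q2, - q1))"
        using mg(8,3)[OF x] e(1) by simp
    qed (use N(2) E(2) e(1) in simp_all)
    moreover have "keys f = {S, S + (q2, q1)}"
    proof (rule seg2)
      fix x assume x: "x \<in> keys f"
      show "wt w2 x = wt w2 S"
        using mf(4,8)[OF x] mf(3)[OF S(1)] e(3) by simp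
      show "wt w1 S \<le> wt w1 x \<and> wt w1 x \<le> wt w1 (S + (q2, q1))"
        using mf(6,1)[OF x] e(4) by simp
    qed (use S(1) E(1) e(4) in simp_all)
    ultimately show ?thesis by blast
  qed
qed

section \<open>Finite sums and products\<close>

lemma prod_single:
  "(\<Prod>i\<in>I. Poly_Mapping.single (a i) (c i)) = (Poly_Mapping.single (\<Sum>i\<in>I. a i) (\<Prod>i\<in>I. c i) :: lpoly)"
  by (induction I rule: infinite_finite_induct) (auto simp: mult_single)

lemma sum_le_card_eqD:
  fixes f :: "'a \<Rightarrow> int"
  assumes "finite S" "\<And>x. x \<in> S \<Longrightarrow> f x \<le> 1" "sum f S = int (card S)" "x \<in> S"
  shows "f x = 1"
proof -
  have "(\<Sum>x\<in>S. 1 - f x) = 0" using assms(3) by (simp add: sum_subtractf)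
  then have "\<forall>x\<in>S. 1 - f x = 0" using assms(1,2) by (subst (asm) sum_nonneg_eq_0_iff) auto
  with assms(4) show ?thesis by auto
qed

lemma sum_eq_1_cases:
  fixes f :: "'a \<Rightarrow> int"
  assumes "finite S" "\<And>x. x \<in> S \<Longrightarrow> f x \<ge> 0" "sum f S = 1"
  obtains n where "n \<in> S" "f n = 1" "\<And>m. m \<in> S \<Longrightarrow> m \<noteq> n \<Longrightarrow> f m = 0"
proof -
  obtain n where n: "n \<in> S" "f n \<noteq> 0"
    using assms(3) by (metis sum.neutral zero_neq_one)
  have "f n + sum f (S - {n}) = 1" using assms(1,3) n(1) by (simp add: sum.remove)
  moreover have "sum f (S - {n}) \<ge> 0" using assms(2) by (intro sum_nonneg) auto
  moreover have "f n \<ge> 1" using assms(2)[OF n(1)] n(2) by simp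
  ultimately have "f n = 1" "sum f (S - {n}) = 0" by auto
  moreover from this(2) have "\<forall>m\<in>S - {n}. f m = 0"
    using assms(1,2) by (subst (asm) sum_nonneg_eq_0_iff) auto
  ultimately show ?thesis using that n(1) by blast
qed

section \<open>Expansion of the determinant on the torus\<close>

locale torus =
  fixes q1 q2 :: nat
  assumes q1_pos: "q1 > 0" and q2_pos: "q2 > 0" and cop: "coprime q1 q2"
begin

abbreviation "W \<equiv> fundamental_domain q1 q2"

definition wrap :: "int \<times> int \<Rightarrow> int \<times> int" where
  "wrap n = (fst n mod int q1, snd n mod int q2)"

text \<open>Exponents of \<open>z1\<close> and \<open>z2\<close> picked up when a lattice point is
  brought back into \<open>W\<close>.\<close>

definition cell :: "int \<times> int \<Rightarrow> int \<times> int" where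
  "cell n = (fst n div int q1, snd n div int q2)"

text \<open>A term of the expanded determinant is given by choosing, for each site, one of the four
  neighbour directions or \<open>(0, 0)\<close> (the diagonal entry) such that \<open>hop\<close> is a permutation.\<close>

definition moves :: "(int \<times> int) set" where
  "moves = insert (0, 0) neighbors_dirs"

definition weight :: "(int \<times> int \<Rightarrow> complex) \<Rightarrow> complex \<Rightarrow> int \<times> int \<Rightarrow> int \<times> int \<Rightarrow> complex" where
  "weight V lam m d = (if d = (0, 0) then V m - lam else - 1)"

definition hop :: "(int \<times> int \<Rightarrow> int \<times> int) \<Rightarrow> int \<times> int \<Rightarrow> int \<times> int" where
  "hop \<delta> m = (if m \<in> W then wrap (m + \<delta> m) else m)"

text \<open>Terms are indexed by moves, not by permutations: for periods 1 and 2 different moves may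
  reach the same site with different exponents. Extensionality outside \<open>W\<close> counts each
  choice once.\<close>

definition admissible :: "(int \<times> int \<Rightarrow> int \<times> int) set" where
  "admissible = {\<delta> \<in> W \<rightarrow>\<^sub>E moves. hop \<delta> permutes W}"

text \<open>Exponent of the term: the net number of crossings of the period boundaries.\<close>

definition winding :: "(int \<times> int \<Rightarrow> int \<times> int) \<Rightarrow> int \<times> int" where
  "winding \<delta> = (\<Sum>m\<in>W. cell (m + \<delta> m))"

definition term_coeff :: "(int \<times> int \<Rightarrow> complex) \<Rightarrow> complex \<Rightarrow> (int \<times> int \<Rightarrow> int \<times> int) \<Rightarrow> complex" where
  "term_coeff V lam \<delta> = of_int (sign (hop \<delta>)) * (\<Prod>m\<in>W. weight V lam m (\<delta> m))"

lemma finite_W [simp]: "finite W"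
  by (simp add: fundamental_domain_def)

lemma card_W: "card W = q1 * q2"
  by (simp add: fundamental_domain_def)

lemma finite_moves [simp]: "finite moves"
  by (simp add: moves_def neighbors_dirs_def)

lemma finite_admissible [simp]: "finite admissible"
  unfolding admissible_def by (rule finite_subset[of _ "W \<rightarrow>\<^sub>E moves"]) (auto intro: finite_PiE)

lemma wrap_in_W [simp]: "wrap n \<in> W"
  using q1_pos q2_pos by (simp add: wrap_def fundamental_domain_def)

lemma wrap_id: "m \<in> W \<Longrightarrow> wrap m = m"
  by (auto simp: wrap_def fundamental_domain_def)

lemma cell_W: "m \<in> W \<Longrightarrow> cell m = (0, 0)"
  by (auto simp: cell_def fundamental_domain_def)

lemma wrap_add_left [simp]: "wrap (wrap x + y) = wrap (x + y)"
  by (simp add: wrap_def mod_simps)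

lemma wrap_cell:
  "fst n = fst (wrap n) + int q1 * fst (cell n)" "snd n = snd (wrap n) + int q2 * snd (cell n)"
  by (simp_all add: wrap_def cell_def)

lemma wrap_add_right_cancel: "wrap (x + y) = wrap (x' + y) \<longleftrightarrow> wrap x = wrap x'"
  by (auto simp: wrap_def mod_eq_dvd_iff)

lemma floquet_entry_eq:
  assumes "m \<in> W"
  shows "floquet_entry q1 q2 V m w - (if m = w then lconst lam else 0) =
    (\<Sum>d\<in>moves. if wrap (m + d) = w then Poly_Mapping.single (cell (m + d)) (weight V lam m d) else 0)"
proof -
  have "(\<Sum>d\<in>neighbors_dirs. if wrap (m + d) = w
        then Poly_Mapping.single (cell (m + d)) (weight V lam m d) else 0) =
      (\<Sum>d\<in>neighbors_dirs. - (if wrap (m + d) = w then lmonom (cell (m + d)) else 0))"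
    by (intro sum.cong refl)
      (auto simp: weight_def neighbors_dirs_def lmonom_def simp flip: single_uminus)
  moreover have "(0, 0) \<notin> neighbors_dirs" "finite neighbors_dirs"
    by (simp_all add: neighbors_dirs_def)
  ultimately have "(\<Sum>d\<in>moves. if wrap (m + d) = w
      then Poly_Mapping.single (cell (m + d)) (weight V lam m d) else 0) =
    (if m = w then Poly_Mapping.single (0, 0) (V m - lam) else 0)
      - (\<Sum>d\<in>neighbors_dirs. if wrap (m + d) = w then lmonom (cell (m + d)) else 0)"
    using wrap_id[OF assms] cell_W[OF assms]
    by (cases "m = w") (auto simp: moves_def sum_negf weight_def simp flip: zero_prod_def)
  then show ?thesis
    unfolding floquet_entry_def Let_def wrap_def[symmetric] cell_def[symmetric]
    by (simp add: lconst_def single_diff)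
qed

lemma floquet_poly_expansion:
  "floquet_poly q1 q2 V lam = (\<Sum>\<delta>\<in>admissible. Poly_Mapping.single (winding \<delta>) (term_coeff V lam \<delta>))"
proof -
  define F where "F m d w = (if wrap (m + d) = w
    then Poly_Mapping.single (cell (m + d)) (weight V lam m d) else 0 :: lpoly)" for m d w
  \<comment> \<open>For fixed moves only the permutation \<open>hop \<delta>\<close> survives: any
    other differs from it at a site of \<open>W\<close>, where the factor vanishes.\<close>
  have prod_F: "of_int (sign p) * (\<Prod>m\<in>W. F m (\<delta> m) (p m)) =
      (if p = hop \<delta> then Poly_Mapping.single (winding \<delta>) (term_coeff V lam \<delta>) else 0)"
    if "p permutes W" for p \<delta>
  proof (cases "p = hop \<delta>")
    case True
    then have "(\<Prod>m\<in>W. F m (\<delta> m) (p m)) =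
        (\<Prod>m\<in>W. Poly_Mapping.single (cell (m + \<delta> m)) (weight V lam m (\<delta> m)))"
      by (intro prod.cong) (auto simp: F_def hop_def)
    also have "\<dots> = Poly_Mapping.single (winding \<delta>) (\<Prod>m\<in>W. weight V lam m (\<delta> m))"
      by (simp add: prod_single winding_def)
    finally show ?thesis
      using True by (simp add: term_coeff_def mult_single flip: single_of_int)
  next
    case False
    then obtain m where "p m \<noteq> hop \<delta> m" by blast
    then have "m \<in> W" using permutes_not_in[OF that, of m] by (cases "m \<in> W") (simp_all add: hop_def)
    with \<open>p m \<noteq> hop \<delta> m\<close> have "F m (\<delta> m) (p m) = 0" by (auto simp: F_def hop_def)
    with \<open>m \<in> W\<close> have "(\<Prod>m\<in>W. F m (\<delta> m) (p m)) = 0"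
      by (intro prod_zero) auto
    with False show ?thesis by simp
  qed
  have "floquet_poly q1 q2 V lam = (\<Sum>p | p permutes W. of_int (sign p) * (\<Prod>m\<in>W. \<Sum>d\<in>moves. F m d (p m)))"
    unfolding floquet_poly_def det_on_def F_def
    by (intro sum.cong refl arg_cong2[where f = "(*)"] prod.cong) (rule floquet_entry_eq)
  also have "\<dots> = (\<Sum>p | p permutes W. \<Sum>\<delta>\<in>W \<rightarrow>\<^sub>E moves. of_int (sign p) * (\<Prod>m\<in>W. F m (\<delta> m) (p m)))"
    by (simp add: prod_sum_PiE sum_distrib_left)
  also have "\<dots> = (\<Sum>\<delta>\<in>W \<rightarrow>\<^sub>E moves. \<Sum>p | p permutes W. of_int (sign p) * (\<Prod>m\<in>W. F m (\<delta> m) (p m)))"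
    by (rule sum.swap)
  also have "\<dots> = (\<Sum>\<delta>\<in>W \<rightarrow>\<^sub>E moves. \<Sum>p | p permutes W.
      if p = hop \<delta> then Poly_Mapping.single (winding \<delta>) (term_coeff V lam \<delta>) else 0)"
    by (intro sum.cong refl) (auto simp: prod_F)
  also have "\<dots> = (\<Sum>\<delta>\<in>W \<rightarrow>\<^sub>E moves. if hop \<delta> permutes W
      then Poly_Mapping.single (winding \<delta>) (term_coeff V lam \<delta>) else 0)"
    by (intro sum.cong refl) (simp add: finite_permutations)
  also have "\<dots> = (\<Sum>\<delta>\<in>admissible. Poly_Mapping.single (winding \<delta>) (term_coeff V lam \<delta>))"
    unfolding admissible_def by (rule sum.inter_filter[symmetric]) (auto intro: finite_PiE)
  finally show ?thesis .
qed

lemma lookup_floquet_poly: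
  "lookup (floquet_poly q1 q2 V lam) a = (\<Sum>\<delta> | \<delta> \<in> admissible \<and> winding \<delta> = a. term_coeff V lam \<delta>)"
  unfolding floquet_poly_expansion lookup_sum
  by (simp add: lookup_single when_def sum.inter_filter)

section \<open>Exponents: the rhombus and its vertices\<close>

text \<open>As \<open>hop \<delta>\<close> permutes \<open>W\<close>, the coordinates of sources and
  targets cancel in the sum, leaving only the moves.\<close>

lemma winding_eq:
  assumes "\<delta> \<in> admissible"
  shows "int q1 * fst (winding \<delta>) = (\<Sum>m\<in>W. fst (\<delta> m))"
    and "int q2 * snd (winding \<delta>) = (\<Sum>m\<in>W. snd (\<delta> m))"
proof -
  have p: "hop \<delta> permutes W" using assms by (simp add: admissible_def)
  have s: "(\<Sum>m\<in>W. fst (hop \<delta> m)) = (\<Sum>m\<in>W. fst m)" "(\<Sum>m\<in>W. snd (hop \<delta> m)) = (\<Sum>m\<in>W. snd m)"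
    using sum.permute[OF p, of fst] sum.permute[OF p, of snd] by (simp_all add: o_def)
  have f: "fst (sum g W) = (\<Sum>m\<in>W. fst (g m))" "snd (sum g W) = (\<Sum>m\<in>W. snd (g m))"
    for g :: "int \<times> int \<Rightarrow> int \<times> int"
    by (simp_all add: fst_sum snd_sum)
  have "int q1 * fst (winding \<delta>) = (\<Sum>m\<in>W. fst m + fst (\<delta> m) - fst (hop \<delta> m))"
    unfolding winding_def f sum_distrib_left
  proof (rule sum.cong[OF refl])
    fix m assume "m \<in> W"
    then show "int q1 * fst (cell (m + \<delta> m)) = fst m + fst (\<delta> m) - fst (hop \<delta> m)"
      using wrap_cell(1)[of "m + \<delta> m"] by (simp add: hop_def)
  qed
  then show "int q1 * fst (winding \<delta>) = (\<Sum>m\<in>W. fst (\<delta> m))"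
    by (simp add: sum.distrib sum_subtractf s)
  have "int q2 * snd (winding \<delta>) = (\<Sum>m\<in>W. snd m + snd (\<delta> m) - snd (hop \<delta> m))"
    unfolding winding_def f sum_distrib_left
  proof (rule sum.cong[OF refl])
    fix m assume "m \<in> W"
    then show "int q2 * snd (cell (m + \<delta> m)) = snd m + snd (\<delta> m) - snd (hop \<delta> m)"
      using wrap_cell(2)[of "m + \<delta> m"] by (simp add: hop_def)
  qed
  then show "int q2 * snd (winding \<delta>) = (\<Sum>m\<in>W. snd (\<delta> m))"
    by (simp add: sum.distrib sum_subtractf s)
qed

lemma admissible_moves: "\<delta> \<in> admissible \<Longrightarrow> m \<in> W \<Longrightarrow> \<delta> m \<in> moves"
  by (auto simp: admissible_def)

text \<open>Each of the \<open>q1 * q2\<close> sites contributes a move of l1-norm at most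
  1.\<close>

lemma keys_floquet_poly_rhombus:
  assumes "c \<in> keys (floquet_poly q1 q2 V lam)"
  shows "int q1 * \<bar>fst c\<bar> + int q2 * \<bar>snd c\<bar> \<le> int q1 * int q2"
proof -
  from assms have "{\<delta> \<in> admissible. winding \<delta> = c} \<noteq> {}"
    unfolding in_keys_iff lookup_floquet_poly by force
  then obtain \<delta> where d: "\<delta> \<in> admissible" "winding \<delta> = c" by blast
  have "int q1 * \<bar>fst c\<bar> + int q2 * \<bar>snd c\<bar> = \<bar>int q1 * fst c\<bar> + \<bar>int q2 * snd c\<bar>"
    by (simp add: abs_mult)
  also have "\<dots> = \<bar>\<Sum>m\<in>W. fst (\<delta> m)\<bar> + \<bar>\<Sum>m\<in>W. snd (\<delta> m)\<bar>"
    using winding_eq[OF d(1)] d(2) by simp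
  also have "\<dots> \<le> (\<Sum>m\<in>W. \<bar>fst (\<delta> m)\<bar>) + (\<Sum>m\<in>W. \<bar>snd (\<delta> m)\<bar>)"
    by (intro add_mono sum_abs)
  also have "\<dots> = (\<Sum>m\<in>W. \<bar>fst (\<delta> m)\<bar> + \<bar>snd (\<delta> m)\<bar>)" by (simp add: sum.distrib)
  also have "\<dots> \<le> (\<Sum>m\<in>W. 1)"
  proof (rule sum_mono)
    fix m assume "m \<in> W"
    from admissible_moves[OF d(1) this] show "\<bar>fst (\<delta> m)\<bar> + \<bar>snd (\<delta> m)\<bar> \<le> 1"
      by (auto simp: moves_def neighbors_dirs_def)
  qed
  also have "\<dots> = int q1 * int q2" by (simp add: card_W)
  finally show ?thesis .
qed

lemma hop_permutesI:
  assumes "inj_on (\<lambda>m. wrap (m + \<delta> m)) W"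
  shows "hop \<delta> permutes W"
proof (rule bij_imp_permutes)
  have "inj_on (hop \<delta>) W" by (rule inj_on_cong[THEN iffD1, OF _ assms]) (simp add: hop_def)
  moreover have "hop \<delta> ` W \<subseteq> W" by (auto simp: hop_def)
  ultimately show "bij_betw (hop \<delta>) W W"
    using endo_inj_surj[OF finite_W] by (auto simp: bij_betw_def)
qed (simp add: hop_def)

lemma translation_permutes: "hop (\<lambda>_. v) permutes W"
  by (rule hop_permutesI) (auto intro!: inj_onI simp: wrap_add_right_cancel wrap_id)

lemma hop_restrict: "hop (restrict \<delta> W) = hop \<delta>"
  by (auto simp: hop_def)

lemma neighbor_inner_move:
  assumes "d \<in> neighbors_dirs" "x \<in> moves"
  shows "fst d * fst x + snd d * snd x \<le> 1"
    and "fst d * fst x + snd d * snd x = 1 \<Longrightarrow> x = d"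
  using assms by (auto simp: moves_def neighbors_dirs_def)

text \<open>The moves of a term with exponent \<open>a\<close> have total inner product
  \<open>q1 * q2\<close> with \<open>d\<close>, at most 1 per site, so all equal \<open>d\<close>:
  nothing can cancel this single term. The scaled equations for \<open>a\<close> treat the four
  vertices at once.\<close>

lemma vertex_in_keys:
  assumes d: "d \<in> neighbors_dirs"
    and a: "int q1 * fst a = int (q1 * q2) * fst d" "int q2 * snd a = int (q1 * q2) * snd d"
  shows "a \<in> keys (floquet_poly q1 q2 V lam)"
proof -
  define \<delta>\<^sub>0 where "\<delta>\<^sub>0 = restrict (\<lambda>_. d) W"
  have adm: "\<delta>\<^sub>0 \<in> admissible"
    using d translation_permutes
    by (auto simp: admissible_def \<delta>\<^sub>0_def hop_restrict moves_def)
  have "int q1 * fst (winding \<delta>\<^sub>0) = int q1 * fst a" "int q2 * snd (winding \<delta>\<^sub>0) = int q2 * snd a"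
    unfolding winding_eq[OF adm] a by (simp_all add: \<delta>\<^sub>0_def card_W)
  then have wind: "winding \<delta>\<^sub>0 = a" using q1_pos q2_pos by (simp add: prod_eq_iff)
  have "\<delta> = \<delta>\<^sub>0" if "\<delta> \<in> admissible" "winding \<delta> = a" for \<delta>
  proof (rule ext)
    fix m
    show "\<delta> m = \<delta>\<^sub>0 m"
    proof (cases "m \<in> W")
      case True
      have mv: "\<delta> x \<in> moves" if "x \<in> W" for x using \<open>\<delta> \<in> admissible\<close> that by (rule admissible_moves)
      have "(\<Sum>x\<in>W. fst d * fst (\<delta> x) + snd d * snd (\<delta> x)) =
          fst d * (int q1 * fst a) + snd d * (int q2 * snd a)"
        using winding_eq[OF that(1)] that(2) by (simp add: sum.distrib sum_distrib_left)
      also have "\<dots> = int (card W)"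
        unfolding a card_W using d by (auto simp: neighbors_dirs_def)
      finally have s: "(\<Sum>x\<in>W. fst d * fst (\<delta> x) + snd d * snd (\<delta> x)) = int (card W)" .
      have "fst d * fst (\<delta> m) + snd d * snd (\<delta> m) = 1"
        by (rule sum_le_card_eqD[OF finite_W _ s True])
          (rule neighbor_inner_move(1)[OF d mv])
      then have "\<delta> m = d" by (rule neighbor_inner_move(2)[OF d mv[OF True]])
      then show ?thesis using True by (simp add: \<delta>\<^sub>0_def)
    next
      case False
      then show ?thesis
        using that(1) PiE_arb[of \<delta> W "\<lambda>_. moves" m] by (simp add: admissible_def \<delta>\<^sub>0_def)
    qed
  qed
  with adm wind have "{\<delta>. \<delta> \<in> admissible \<and> winding \<delta> = a} = {\<delta>\<^sub>0}" by blast
  then have coeff: "lookup (floquet_poly q1 q2 V lam) a = term_coeff V lam \<delta>\<^sub>0"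
    by (simp add: lookup_floquet_poly)
  have "weight V lam m (\<delta>\<^sub>0 m) \<noteq> 0" if "m \<in> W" for m
    using that d by (auto simp: weight_def \<delta>\<^sub>0_def neighbors_dirs_def)
  then have "term_coeff V lam \<delta>\<^sub>0 \<noteq> 0" by (simp add: term_coeff_def)
  with coeff show ?thesis by (simp add: in_keys_iff)
qed

section \<open>The torus as a cyclic group\<close>

abbreviation "Q \<equiv> int q1 * int q2"

lemma Q_pos: "Q > 0"
  using q1_pos q2_pos by simp

text \<open>Since \<open>q1\<close> and \<open>q2\<close> are coprime, the torus is cyclic of order \<open>Q\<close>, generated by
  \<open>(1, -1)\<close>; \<open>idx\<close> is the discrete logarithm to this base and \<open>unit1\<close> represents \<open>idx (1, 0)\<close>.\<close>

definition unit1 :: int where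
  "unit1 = (SOME \<alpha>. int q1 dvd \<alpha> - 1 \<and> int q2 dvd \<alpha>)"

lemma unit1: "int q1 dvd unit1 - 1" "int q2 dvd unit1"
proof -
  have "coprime (int q1) (int q2)" using cop by simp
  \<comment> \<open>In the Bezout relation, \<open>v * int q2\<close> is 1 modulo \<open>q1\<close>
    and 0 modulo \<open>q2\<close>.\<close>
  then obtain u v where "u * int q1 + v * int q2 = 1"
    using bezout_int[of "int q1" "int q2"] by auto
  then have "int q1 dvd v * int q2 - 1 \<and> int q2 dvd v * int q2"
    by (metis add_diff_cancel_right' dvd_minus_iff dvd_triv_right minus_diff_eq)
  then have "int q1 dvd unit1 - 1 \<and> int q2 dvd unit1" unfolding unit1_def by (rule someI)
  then show "int q1 dvd unit1 - 1" "int q2 dvd unit1" by auto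
qed

definition idx :: "int \<times> int \<Rightarrow> int" where
  "idx m = (fst m * unit1 + snd m * (unit1 - 1)) mod Q"

lemma idx_range: "0 \<le> idx m" "idx m < Q"
  using Q_pos by (simp_all add: idx_def)

text \<open>Chinese remainders: \<open>unit1\<close> is 1 modulo \<open>q1\<close> and 0 modulo
  \<open>q2\<close>, so the difference of indices becomes \<open>x\<close> and \<open>- y\<close>
  respectively.\<close>

lemma idx_eq_iff: "idx a = idx b \<longleftrightarrow> wrap a = wrap b"
proof -
  define x y where "x = fst a - fst b" and "y = snd a - snd b"
  have "idx a = idx b \<longleftrightarrow> Q dvd x * unit1 + y * (unit1 - 1)"
    by (simp add: idx_def mod_eq_dvd_iff x_def y_def algebra_simps)
  also have "\<dots> \<longleftrightarrow> int q1 dvd x * unit1 + y * (unit1 - 1) \<and> int q2 dvd x * unit1 + y * (unit1 - 1)"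
    using cop by (auto intro: divides_mult dest: dvd_mult_left dvd_mult_right)
  also have "int q1 dvd x * unit1 + y * (unit1 - 1) \<longleftrightarrow> int q1 dvd x"
  proof -
    have "x * unit1 + y * (unit1 - 1) = (x + y) * (unit1 - 1) + x" by (simp add: algebra_simps)
    then show ?thesis using unit1(1) by (simp add: dvd_add_right_iff)
  qed
  also have "int q2 dvd x * unit1 + y * (unit1 - 1) \<longleftrightarrow> int q2 dvd y"
  proof -
    have "x * unit1 + y * (unit1 - 1) = (x + y) * unit1 - y" by (simp add: algebra_simps)
    then show ?thesis using unit1(2) by (simp add: dvd_diff_right_iff)
  qed
  also have "int q1 dvd x \<and> int q2 dvd y \<longleftrightarrow> wrap a = wrap b"
    by (simp add: wrap_def mod_eq_dvd_iff x_def y_def)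
  finally show ?thesis .
qed

lemma wrap_diff_right_cancel: "wrap (x - y) = wrap (x' - y) \<longleftrightarrow> wrap x = wrap x'"
  using wrap_add_right_cancel[of x "- y" x'] by simp

lemma idx_diff_inj: "m \<in> W \<Longrightarrow> m' \<in> W \<Longrightarrow> idx (m - n) = idx (m' - n) \<Longrightarrow> m = m'"
  by (metis idx_eq_iff wrap_diff_right_cancel wrap_id)

lemma bij_betw_idx_diff: "bij_betw (\<lambda>m. idx (m - n)) W {0..<Q}"
proof -
  have inj: "inj_on (\<lambda>m. idx (m - n)) W" by (rule inj_onI) (rule idx_diff_inj)
  have "(\<lambda>m. idx (m - n)) ` W = {0..<Q}"
  proof (rule card_subset_eq)
    show "(\<lambda>m. idx (m - n)) ` W \<subseteq> {0..<Q}"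
      by (rule image_subsetI) (simp add: idx_range)
    show "card ((\<lambda>m. idx (m - n)) ` W) = card {0..<Q}"
      by (simp add: card_image[OF inj] card_W nat_mult_distrib)
  qed simp
  with inj show ?thesis by (simp add: bij_betw_def)
qed

text \<open>Index from which the move \<open>(1, 0)\<close> reaches index 0. The extremes 0 and
  \<open>Q - 1\<close> occur, for \<open>q1 = 1\<close> and \<open>q2 = 1\<close>.\<close>

definition J :: int where
  "J = (- unit1) mod Q"

lemma J_range: "0 \<le> J" "J < Q"
  using Q_pos by (simp_all add: J_def)

lemma idx_add_e1: "idx (m + (1, 0)) = (idx m - J) mod Q"
  by (simp add: idx_def J_def mod_simps algebra_simps)

lemma idx_add_e2: "idx (m + (0, 1)) = (idx m - J - 1) mod Q"
proof -
  have "(x mod Q - y mod Q - 1) mod Q = (x - y - 1) mod Q" for x y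
    by (metis mod_diff_eq mod_diff_left_eq)
  then show ?thesis unfolding idx_def J_def by (simp add: algebra_simps)
qed

section \<open>Configurations with one fixed site\<close>

text \<open>\<open>defect n\<close> keeps the site \<open>n\<close> fixed and moves every other site by \<open>(1, 0)\<close> or \<open>(0, 1)\<close>.
  In terms of the index relative to \<open>n\<close> these moves are \<open>k \<mapsto> k - J\<close> and \<open>k \<mapsto> k - J - 1\<close>.
  The target 0 is occupied by \<open>n\<close>, so the site \<open>J\<close> cannot use the first move and \<open>J + 1\<close> cannot
  use the second; injectivity then propagates the choice to all smaller and all larger indices.\<close>

definition step :: "int \<Rightarrow> int \<times> int" where
  "step k = (if k = 0 then (0, 0) else if k \<le> J then (0, 1) else (1, 0))"

definition defect :: "int \<times> int \<Rightarrow> int \<times> int \<Rightarrow> int \<times> int" where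
  "defect n = restrict (\<lambda>m. step (idx (m - n))) W"

lemma idx_step:
  "idx (m + step (idx (m - n)) - n) =
    (if idx (m - n) = 0 then 0 else if idx (m - n) \<le> J then idx (m - n) - J - 1 else idx (m - n) - J) mod Q"
proof -
  have e: "(m - n) + x = m + x - n" for x by simp
  show ?thesis
    using idx_range[of "m - n"] idx_add_e1[of "m - n", unfolded e] idx_add_e2[of "m - n", unfolded e]
    by (simp add: step_def flip: zero_prod_def)
qed

text \<open>Indices 1 to \<open>J\<close> go to \<open>- J\<close> to -1, those above
  \<open>J\<close> to 1 to \<open>Q - J - 1\<close>, and 0 stays: distinct integers in a window of
  length \<open>Q\<close>, hence distinct modulo \<open>Q\<close>.\<close>

lemma defect_admissible: "defect n \<in> admissible"
proof -
  define \<phi> where "\<phi> k = (if k = 0 then 0 else if k \<le> J then k - J - 1 else k - J)" for k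
  have \<phi>_range: "- J \<le> \<phi> k" "\<phi> k < Q - J" if "0 \<le> k" "k < Q" for k
    using that J_range by (auto simp: \<phi>_def)
  have \<phi>_inj: "k = k'" if "\<phi> k = \<phi> k'" "0 \<le> k" "0 \<le> k'" for k k'
    using that by (auto simp: \<phi>_def split: if_splits)
  have "inj_on (\<lambda>m. wrap (m + step (idx (m - n)))) W"
  proof (rule inj_onI)
    fix m m' assume m: "m \<in> W" "m' \<in> W" and eq: "wrap (m + step (idx (m - n))) = wrap (m' + step (idx (m' - n)))"
    then have "idx (m + step (idx (m - n)) - n) = idx (m' + step (idx (m' - n)) - n)"
      by (simp add: idx_eq_iff wrap_diff_right_cancel)
    then have "\<phi> (idx (m - n)) mod Q = \<phi> (idx (m' - n)) mod Q"
      by (simp add: idx_step \<phi>_def)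
    \<comment> \<open>Adding \<open>J\<close> makes the window start at 0, where reduction modulo
      \<open>Q\<close> is the identity.\<close>
    then have "(\<phi> (idx (m - n)) + J) mod Q = (\<phi> (idx (m' - n)) + J) mod Q"
      by (rule mod_add_cong) simp
    then have "\<phi> (idx (m - n)) = \<phi> (idx (m' - n))"
      using \<phi>_range[OF idx_range, of "m - n"] \<phi>_range[OF idx_range, of "m' - n"]
      by (simp add: mod_pos_pos_trivial)
    then have "idx (m - n) = idx (m' - n)" using \<phi>_inj idx_range by blast
    then show "m = m'" using m idx_diff_inj by blast
  qed
  then have "hop (defect n) permutes W"
    unfolding defect_def hop_restrict by (rule hop_permutesI)
  then show ?thesis
    by (auto simp: admissible_def defect_def step_def moves_def neighbors_dirs_def)
qed

lemma defect_unique: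
  assumes adm: "\<delta> \<in> admissible" and n: "n \<in> W" "\<delta> n = (0, 0)"
    and others: "\<And>m. m \<in> W \<Longrightarrow> m \<noteq> n \<Longrightarrow> \<delta> m = (1, 0) \<or> \<delta> m = (0, 1)"
  shows "\<delta> = defect n"
proof -
  have idx0: "idx 0 = 0" by (simp add: idx_def)
  have nnz: "idx (m - n) \<noteq> 0" if "m \<in> W" "m \<noteq> n" for m
    using idx_diff_inj[OF that(1) n(1), of n] that(2) idx0 by auto
  define r where "r m = idx (m + \<delta> m - n)" for m
  have r_inj: "m = m'" if "r m = r m'" "m \<in> W" "m' \<in> W" for m m'
  proof -
    have "hop \<delta> m = hop \<delta> m'"
      using that by (simp add: hop_def r_def idx_eq_iff wrap_diff_right_cancel)
    moreover have "inj (hop \<delta>)" using adm by (auto simp: admissible_def intro: permutes_inj)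
    ultimately show ?thesis by (simp add: inj_eq)
  qed
  have r_n: "r n = 0"
    using idx0 n(2) by (simp add: r_def flip: zero_prod_def)
  have r_e1: "r m = (idx (m - n) - J) mod Q" if "\<delta> m = (1, 0)" for m
    using idx_add_e1[of "m - n"] that by (simp add: r_def algebra_simps)
  have r_e2: "r m = (idx (m - n) - J - 1) mod Q" if "\<delta> m = (0, 1)" for m
    using idx_add_e2[of "m - n"] that by (simp add: r_def algebra_simps)
  have site: "\<exists>m\<in>W. idx (m - n) = k" if "0 \<le> k" "k < Q" for k
  proof -
    have "k \<in> (\<lambda>m. idx (m - n)) ` W"
      using bij_betw_imp_surj_on[OF bij_betw_idx_diff[of n]] that by simp
    then show ?thesis by auto
  qed
  \<comment> \<open>With \<open>(0, 1)\<close>, the site of index \<open>k + 1\<close> would land on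
    \<open>k - J\<close> modulo \<open>Q\<close>, the target of the site of index
    \<open>k\<close>.\<close>
  have succ: "\<delta> m' = (1, 0)"
    if "m \<in> W" "m' \<in> W" "m \<noteq> n" "idx (m' - n) = idx (m - n) + 1" "\<delta> m = (1, 0)" for m m'
  proof (rule ccontr)
    assume "\<delta> m' \<noteq> (1, 0)"
    moreover have "m' \<noteq> n" using that(4) idx0 idx_range[of "m - n"] by auto
    ultimately have "\<delta> m' = (0, 1)" using others that(2) by blast
    then have "r m' = r m" using r_e2 r_e1 that(4,5) by simp
    then have "m' = m" using r_inj that(1,2) by blast
    with that(4) show False by simp
  qed
  have up: "\<forall>m'\<in>W. idx (m' - n) = k \<longrightarrow> \<delta> m' = (1, 0)"
    if "m \<in> W" "m \<noteq> n" "\<delta> m = (1, 0)" "idx (m - n) \<le> k" for m k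
    using that(4)
  proof (induction k rule: int_ge_induct)
    case base
    then show ?case using idx_diff_inj that(1,3) by metis
  next
    case (step k)
    show ?case
    proof clarify
      fix m' assume m': "m' \<in> W" "idx (m' - n) = k + 1"
      have "0 \<le> k" "k < Q" using step.hyps idx_range[of "m - n"] idx_range[of "m' - n"] m' by auto
      then obtain x where x: "x \<in> W" "idx (x - n) = k" using site by blast
      have "x \<noteq> n" using x(2) step.hyps nnz[OF that(1,2)] idx_range[of "m - n"] idx0 by auto
      then show "\<delta> m' = (1, 0)" using succ[OF x(1) m'(1)] x m' step.IH by simp
    qed
  qed
  \<comment> \<open>A move \<open>(1, 0)\<close> at an index up to \<open>J\<close> would propagate
    to \<open>J\<close>, whose target 0 belongs to \<open>n\<close>.\<close>
  have low: "\<delta> m = (0, 1)" if m: "m \<in> W" "m \<noteq> n" "idx (m - n) \<le> J" for m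
  proof (rule ccontr)
    assume "\<delta> m \<noteq> (0, 1)"
    then have e1: "\<delta> m = (1, 0)" using others m by blast
    obtain x where x: "x \<in> W" "idx (x - n) = J" using site J_range by blast
    have "\<delta> x = (1, 0)" using up[OF m(1,2) e1 m(3)] x by blast
    then have "r x = r n" using r_e1 x(2) r_n by simp
    then have "x = n" using r_inj x(1) n(1) by blast
    \<comment> \<open>\<open>n\<close> itself has index \<open>J\<close> only for
      \<open>J = 0\<close>, and then no other site has index at most \<open>J\<close>.\<close>
    then have "J = 0" using x(2) idx0 by simp
    then show False using m(3) nnz[OF m(1,2)] idx_range[of "m - n"] by simp
  qed
  have high: "\<delta> m = (1, 0)" if m: "m \<in> W" "m \<noteq> n" "\<not> idx (m - n) \<le> J" for m
  proof -
    \<comment> \<open>If \<open>J\<close> is the last index, no site lies above it. Otherwise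
      \<open>(0, 1)\<close> would send \<open>J + 1\<close> to 0, so this site uses
      \<open>(1, 0)\<close>, which propagates upwards.\<close>
    have "J + 1 < Q \<or> J + 1 = Q" using J_range by auto
    moreover have "idx (m - n) < Q" by (rule idx_range)
    ultimately have "J + 1 < Q" using m(3) by auto
    then obtain x where x: "x \<in> W" "idx (x - n) = J + 1" using site[of "J + 1"] J_range by auto
    have "x \<noteq> n" using x(2) idx0 J_range by auto
    have "\<delta> x = (1, 0)"
    proof (rule ccontr)
      assume "\<delta> x \<noteq> (1, 0)"
      then have "\<delta> x = (0, 1)" using others x(1) \<open>x \<noteq> n\<close> by blast
      then have "r x = r n" using r_e2 x(2) r_n by simp
      then show False using r_inj x(1) n(1) \<open>x \<noteq> n\<close> by blast
    qed
    then show ?thesis using up[OF x(1) \<open>x \<noteq> n\<close>, of "idx (m - n)"] x(2) m by auto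
  qed
  show ?thesis
  proof (rule ext)
    fix m
    consider "m \<notin> W" | "m = n" | "m \<in> W" "m \<noteq> n" by blast
    then show "\<delta> m = defect n m"
    proof cases
      case 1
      then show ?thesis
        using adm PiE_arb[of \<delta> W "\<lambda>_. moves" m] by (simp add: admissible_def defect_def)
    next
      case 2
      then show ?thesis using n idx0 by (simp add: defect_def step_def)
    next
      case 3
      then show ?thesis using nnz[OF 3] low[OF 3] high[OF 3] by (simp add: defect_def step_def)
    qed
  qed
qed

section \<open>The coefficient next to the edge\<close>

text \<open>Indices relative to \<open>n\<close> fill the same range for every \<open>n\<close>, so
  sums over moves, and with them the winding, do not depend on \<open>n\<close>.\<close>

lemma sum_defect: "(\<Sum>m\<in>W. F (defect n m)) = (\<Sum>k\<in>{0..<Q}. F (step k))"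
proof -
  have "(\<Sum>m\<in>W. F (defect n m)) = (\<Sum>m\<in>W. F (step (idx (m - n))))"
    by (rule sum.cong) (simp_all add: defect_def)
  also have "\<dots> = (\<Sum>k\<in>{0..<Q}. F (step k))"
    by (rule sum.reindex_bij_betw[OF bij_betw_idx_diff])
  finally show ?thesis .
qed

lemma winding_defect: "winding (defect n) = winding (defect n')"
proof -
  have "int q1 * fst (winding (defect n)) = int q1 * fst (winding (defect n'))"
    "int q2 * snd (winding (defect n)) = int q2 * snd (winding (defect n'))"
    by (simp_all only: winding_eq[OF defect_admissible] sum_defect)
  then show ?thesis using q1_pos q2_pos by (simp add: prod_eq_iff)
qed

lemma winding_defect_layer:
  "int q1 * fst (winding (defect n)) + int q2 * snd (winding (defect n)) = Q - 1"
proof -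
  have "int q1 * fst (winding (defect n)) + int q2 * snd (winding (defect n)) =
      (\<Sum>k\<in>{0..<Q}. fst (step k) + snd (step k))"
    by (simp only: winding_eq[OF defect_admissible] sum_defect sum.distrib)
  also have "\<dots> = (\<Sum>k\<in>{0..<Q}. 1 - (if k = 0 then 1 else 0))"
    by (intro sum.cong) (auto simp: step_def)
  also have "\<dots> = Q - 1" using Q_pos by (simp add: sum_subtractf)
  finally show ?thesis .
qed

text \<open>Translation by \<open>n\<close> conjugates \<open>hop (defect 0)\<close> into
  \<open>hop (defect n)\<close>, and conjugate permutations have equal sign.\<close>

lemma sign_hop_defect: "sign (hop (defect n)) = sign (hop (defect 0))"
proof -
  have perm: "permutation (hop (defect m))" "permutation (hop (\<lambda>_. n))" for m
    using defect_admissible[of m] translation_permutes[of n] finite_W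
    unfolding permutation_permutes admissible_def by blast+
  have "hop (defect n) \<circ> hop (\<lambda>_. n) = hop (\<lambda>_. n) \<circ> hop (defect 0)"
  proof (rule ext)
    fix m
    have "idx (wrap (m + n) - n) = idx m"
      by (metis add_diff_cancel_right' idx_eq_iff wrap_diff_right_cancel wrap_id wrap_in_W)
    then show "(hop (defect n) \<circ> hop (\<lambda>_. n)) m = (hop (\<lambda>_. n) \<circ> hop (defect 0)) m"
      by (simp add: hop_def defect_def) (simp add: add_ac)
  qed
  then have "sign (hop (defect n)) * sign (hop (\<lambda>_. n)) = sign (hop (\<lambda>_. n)) * sign (hop (defect 0))"
    by (metis sign_compose perm)
  then show ?thesis by simp
qed

lemma term_coeff_defect:
  assumes "n \<in> W"
  shows "term_coeff V lam (defect n) = of_int (sign (hop (defect 0))) * (- 1) ^ (q1 * q2 - 1) * (V n - lam)"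
proof -
  have idx0: "idx 0 = 0" by (simp add: idx_def)
  have "weight V lam m (defect n m) = - 1" if "m \<in> W - {n}" for m
  proof -
    have "idx (m - n) \<noteq> 0" using idx_diff_inj[of m n n] assms that idx0 by auto
    then show ?thesis using that by (auto simp: weight_def defect_def step_def)
  qed
  then have "(\<Prod>m\<in>W - {n}. weight V lam m (defect n m)) = (- 1) ^ (q1 * q2 - 1)"
    using assms by (simp add: card_W)
  moreover have "weight V lam n (defect n n) = V n - lam"
    using assms idx0 by (simp add: weight_def defect_def step_def)
  ultimately have "(\<Prod>m\<in>W. weight V lam m (defect n m)) = (V n - lam) * (- 1) ^ (q1 * q2 - 1)"
    using assms by (simp add: prod.remove)
  then show ?thesis by (simp add: term_coeff_def sign_hop_defect[of n] mult_ac)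
qed

text \<open>The coordinate sums of the moves are at most 1 and total \<open>Q - 1\<close>, so a
  single site falls short, by 1. The only move of coordinate sum 0 is \<open>(0, 0)\<close>.\<close>

lemma layer_admissible:
  assumes adm: "\<delta> \<in> admissible" and "winding \<delta> = winding (defect 0)"
  shows "\<exists>n\<in>W. \<delta> = defect n"
proof -
  have mv: "\<delta> m \<in> moves" if "m \<in> W" for m using adm that by (rule admissible_moves)
  have "(\<Sum>m\<in>W. 1 - (fst (\<delta> m) + snd (\<delta> m))) = 1"
    using winding_eq[OF adm] winding_defect_layer[of 0] assms(2)
    by (simp add: sum_subtractf sum.distrib card_W)
  moreover have "1 - (fst (\<delta> m) + snd (\<delta> m)) \<ge> 0" if "m \<in> W" for m
    using mv[OF that] by (auto simp: moves_def neighbors_dirs_def)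
  ultimately obtain n where n: "n \<in> W" "1 - (fst (\<delta> n) + snd (\<delta> n)) = 1"
    "\<And>m. m \<in> W \<Longrightarrow> m \<noteq> n \<Longrightarrow> 1 - (fst (\<delta> m) + snd (\<delta> m)) = 0"
    using sum_eq_1_cases[OF finite_W, of "\<lambda>m. 1 - (fst (\<delta> m) + snd (\<delta> m))"] by blast
  have "\<delta> n = (0, 0)" using mv[OF n(1)] n(2) by (auto simp: moves_def neighbors_dirs_def)
  moreover have "\<delta> m = (1, 0) \<or> \<delta> m = (0, 1)" if "m \<in> W" "m \<noteq> n" for m
    using mv[OF that(1)] n(3)[OF that] by (auto simp: moves_def neighbors_dirs_def)
  ultimately show ?thesis using defect_unique[OF adm n(1)] n(1) by blast
qed

text \<open>The site with move \<open>(0, 0)\<close> recovers \<open>n\<close>, so each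
  \<open>V n - lam\<close> is counted once.\<close>

lemma inj_on_defect: "inj_on defect W"
proof (rule inj_onI)
  fix n n' assume n: "n \<in> W" "n' \<in> W" and eq: "defect n = defect n'"
  have idx0: "idx 0 = 0" by (simp add: idx_def)
  have "defect n n = (0, 0)" using n idx0 by (simp add: defect_def step_def)
  then have "step (idx (n - n')) = (0, 0)" using n unfolding eq by (simp add: defect_def)
  then have "idx (n - n') = 0" by (simp add: step_def split: if_splits)
  then show "n = n'" using idx_diff_inj[of n n' n'] n idx0 by simp
qed

lemma lookup_floquet_poly_layer:
  "lookup (floquet_poly q1 q2 V lam) (winding (defect 0)) =
    of_int (sign (hop (defect 0))) * (- 1) ^ (q1 * q2 - 1) * of_nat (q1 * q2) * (avg_potential q1 q2 V - lam)"
proof -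
  have "{\<delta>. \<delta> \<in> admissible \<and> winding \<delta> = winding (defect 0)} = defect ` W"
    using layer_admissible defect_admissible winding_defect by blast
  then have "lookup (floquet_poly q1 q2 V lam) (winding (defect 0)) = (\<Sum>n\<in>W. term_coeff V lam (defect n))"
    by (simp add: lookup_floquet_poly sum.reindex[OF inj_on_defect])
  also have "\<dots> = (\<Sum>n\<in>W. of_int (sign (hop (defect 0))) * (- 1) ^ (q1 * q2 - 1) * (V n - lam))"
    by (intro sum.cong refl term_coeff_defect)
  also have "\<dots> = of_int (sign (hop (defect 0))) * (- 1) ^ (q1 * q2 - 1) * (\<Sum>n\<in>W. V n - lam)"
    by (simp add: sum_distrib_left)
  also have "(\<Sum>n\<in>W. V n - lam) = of_nat (q1 * q2) * (avg_potential q1 q2 V - lam)"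
    using q1_pos q2_pos by (simp add: sum_subtractf card_W avg_potential_def right_diff_distrib)
  finally show ?thesis by (simp only: mult.assoc)
qed

section \<open>Factorizations of the Floquet polynomial\<close>

lemma floquet_poly_factors:
  assumes P: "floquet_poly q1 q2 V lam = f * g" and nf: "\<not> is_monomial f" and ng: "\<not> is_monomial g"
  shows "(\<exists>e e'. keys f = {e, e + (int q2, - int q1)} \<and> keys g = {e', e' + (int q2, int q1)}) \<or>
    (\<exists>e e'. keys g = {e, e + (int q2, - int q1)} \<and> keys f = {e', e' + (int q2, int q1)})"
proof (rule rhombus_factor_cases)
  show "int q1 * \<bar>fst c\<bar> + int q2 * \<bar>snd c\<bar> \<le> int q1 * int q2" if "c \<in> keys (f * g)" for c
    using that keys_floquet_poly_rhombus unfolding P[symmetric] by blast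
  show "(int q2, 0) \<in> keys (f * g)" "(- int q2, 0) \<in> keys (f * g)"
    "(0, int q1) \<in> keys (f * g)" "(0, - int q1) \<in> keys (f * g)"
    unfolding P[symmetric]
    by (rule vertex_in_keys[of "(1, 0)"] vertex_in_keys[of "(- 1, 0)"] vertex_in_keys[of "(0, 1)"]
        vertex_in_keys[of "(0, - 1)"]; simp add: neighbors_dirs_def)+
qed (use q1_pos q2_pos cop nf ng in simp_all)

text \<open>The weight \<open>(int q1, int q2)\<close> is constant on \<open>f\<close>, so the
  product has at most two weights, \<open>2 * Q\<close> apart. The vertices
  \<open>(int q2, 0)\<close> and \<open>(- int q2, 0)\<close> make them \<open>Q\<close> and
  \<open>- Q\<close>, which excludes \<open>Q - 1\<close>.\<close>

lemma reducible_imp_avg: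
  assumes P: "floquet_poly q1 q2 V lam = f * g"
    and f: "keys f = {e, e + (int q2, - int q1)}" and g: "keys g = {e', e' + (int q2, int q1)}"
  shows "lam = avg_potential q1 q2 V"
proof (rule ccontr)
  assume "lam \<noteq> avg_potential q1 q2 V"
  then have "winding (defect 0) \<in> keys (f * g)"
    unfolding P[symmetric] in_keys_iff lookup_floquet_poly_layer using q1_pos q2_pos by simp
  moreover have "(int q2, 0) \<in> keys (f * g)" "(- int q2, 0) \<in> keys (f * g)"
    unfolding P[symmetric]
    by (rule vertex_in_keys[of "(1, 0)"] vertex_in_keys[of "(- 1, 0)"]; simp add: neighbors_dirs_def)+
  moreover have wts: "wt (int q1, int q2) c = wt (int q1, int q2) (e + e') \<or>
      wt (int q1, int q2) c = wt (int q1, int q2) (e + e') + 2 * Q" if "c \<in> keys (f * g)" for c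
    using that by (rule keys_multE) (auto simp: f g wt_def algebra_simps)
  ultimately show False
    using wts[of "winding (defect 0)"] wts[of "(int q2, 0)"] wts[of "(- int q2, 0)"]
      winding_defect_layer[of 0] Q_pos by (simp add: wt_def) linarith
qed

end

text \<open>Multiplication by a monomial translates the exponents, and the two segments have
  different slopes.\<close>

lemma binomials_not_associated:
  assumes "q1 > 0" "q2 > 0" "keys f = {e, e + (q2, - q1)}" "keys g = {e', e' + (q2, q1)}"
    and "is_monomial c"
  shows "f \<noteq> c * g"
proof
  assume "f = c * g"
  moreover obtain a where a: "keys c = {a}" using assms(5) by (auto simp: is_monomial_iff_keys)
  ultimately have "keys f \<subseteq> {a + e', a + e' + (q2, q1)}"
    by (auto simp: a assms(4) add.assoc elim!: keys_multE)
  then show False using assms(1-3) by (auto simp: prod_eq_iff)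
qed

theorem mainTheorem5:
  fixes q1 q2 :: nat and V :: "int \<times> int \<Rightarrow> complex"
  assumes "q1 > 0" and "q2 > 0" and "coprime q1 q2"
    and "periodic_potential q1 q2 V"
  shows "(\<forall>lam. lam \<noteq> avg_potential q1 q2 V \<longrightarrow> laurent_irreducible (floquet_poly q1 q2 V lam))
    \<and> (\<not> laurent_irreducible (floquet_poly q1 q2 V (avg_potential q1 q2 V)) \<longrightarrow>
        (\<exists>f g. floquet_poly q1 q2 V (avg_potential q1 q2 V) = f * g
           \<and> \<not> is_monomial f \<and> \<not> is_monomial g
           \<and> laurent_irreducible f \<and> laurent_irreducible g
           \<and> \<not> (\<exists>c. is_monomial c \<and> f = c * g)))"
proof -
  interpret torus q1 q2 using assms(1-3) by unfold_locales
  have factors: "\<exists>f g e e'. floquet_poly q1 q2 V lam = f * g \<and> \<not> is_monomial f \<and> \<not> is_monomial g \<and>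
      keys f = {e, e + (int q2, - int q1)} \<and> keys g = {e', e' + (int q2, int q1)}"
    if red: "\<not> laurent_irreducible (floquet_poly q1 q2 V lam)" for lam
  proof -
    obtain f g where fg: "floquet_poly q1 q2 V lam = f * g" "\<not> is_monomial f" "\<not> is_monomial g"
      using red unfolding laurent_irreducible_def by blast
    \<comment> \<open>Swapping the factors lets \<open>f\<close> always carry the edge
      \<open>(int q2, - int q1)\<close>.\<close>
    then have gf: "floquet_poly q1 q2 V lam = g * f" by (simp add: mult.commute)
    from floquet_poly_factors[OF fg] show ?thesis using fg gf by blast
  qed
  have "laurent_irreducible (floquet_poly q1 q2 V lam)" if "lam \<noteq> avg_potential q1 q2 V" for lam
    using factors[of lam] reducible_imp_avg that by blast
  moreover have "\<exists>f g. floquet_poly q1 q2 V (avg_potential q1 q2 V) = f * g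
      \<and> \<not> is_monomial f \<and> \<not> is_monomial g \<and> laurent_irreducible f \<and> laurent_irreducible g
      \<and> \<not> (\<exists>c. is_monomial c \<and> f = c * g)"
    if red: "\<not> laurent_irreducible (floquet_poly q1 q2 V (avg_potential q1 q2 V))"
  proof -
    obtain f g e e' where fg: "floquet_poly q1 q2 V (avg_potential q1 q2 V) = f * g"
      "\<not> is_monomial f" "\<not> is_monomial g"
      and keys: "keys f = {e, e + (int q2, - int q1)}" "keys g = {e', e' + (int q2, int q1)}"
      using factors[OF red] by blast
    have cop': "coprime (int q2) (- int q1)" "coprime (int q2) (int q1)"
      using assms(3) by (simp_all add: coprime_commute)
    have "laurent_irreducible f" "laurent_irreducible g"
      using binomial_laurent_irreducible[OF cop'(1) keys(1)] binomial_laurent_irreducible[OF cop'(2) keys(2)] .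
    \<comment> \<open>Non-associated irreducible factors are distinct, so each has multiplicity
      one.\<close>
    moreover have "\<not> (\<exists>c. is_monomial c \<and> f = c * g)"
      using binomials_not_associated[OF _ _ keys] assms(1,2) by auto
    ultimately show ?thesis using fg by blast
  qed
  ultimately show ?thesis by blast
qed

end
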